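(* Let $n\ge1$ and $m\ge2$, let $\boldsymbol{r}_j=(r_{1j},\ldots,r_{nj})^T\in\mathbb{R}^n$ and $w_j\in\mathbb{R}$ for $j=1,\ldots,m$, and let $\rho(\boldsymbol{r},\boldsymbol{s})=\max_{1\le i\le n}|r_i-s_i|$ denote the Chebyshev distance on $\mathbb{R}^n$. For each $i=1,\ldots,n$ put $$ p_i=\max(r_{i1}+w_1,\ldots,r_{im}+w_m),\qquad q_i=\min(r_{i1}-w_1,\ldots,r_{im}-w_m). $$ Then the minimum in the problem $$ \min_{\boldsymbol{x}\in\mathbb{R}^n}\ \max_{1\le j\le m}\left(\rho(\boldsymbol{r}_j,\boldsymbol{x})+w_j\right) $$ is given by $\lambda=\max(p_1-q_1,\ldots,p_n-q_n)/2$, and it is attained at any vector $$ \boldsymbol{x}=\alpha\left(\begin{array}{c}p_1-\lambda\\ \vdots\\ p_n-\lambda\end{array}\right)+(1-\alpha)\left(\begin{array}{c}q_1+\lambda\\ \vdots\\ q_n+\lambda\end{array}\right),\qquad 0\le\alpha\le1. $$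
   Context: All operations in this statement are the ordinary arithmetic operations on real numbers and real vectors. *)

theory Defs
  imports "HOL-Analysis.Analysis"
begin

definition chebyshev_dist :: "real ^ 'n \<Rightarrow> real ^ 'n \<Rightarrow> real" where
  "chebyshev_dist r s = (MAX i\<in>UNIV. \<bar>r $ i - s $ i\<bar>)"

definition weighted_max_dist ::
    "nat \<Rightarrow> (nat \<Rightarrow> real ^ 'n) \<Rightarrow> (nat \<Rightarrow> real) \<Rightarrow> real ^ 'n \<Rightarrow> real" where
  "weighted_max_dist m r w x = (MAX j\<in>{1..m}. chebyshev_dist (r j) x + w j)"

end

theory Submission
  imports Defs
begin

text \<open>
  Since \<open>\<bar>a - x\<bar> + w \<le> L\<close> means \<open>a + w - L \<le> x \<le> a - w + L\<close>, the sublevel set of the objective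
  at height \<open>L\<close> is the box \<open>p - L \<le> x \<le> q + L\<close>. It is nonempty exactly when
  \<open>p $ i - q $ i \<le> 2 * L\<close> for all \<open>i\<close>, that is when \<open>lam \<le> L\<close>, and the vectors in the claim
  lie on the diagonal of the box at height \<open>lam\<close>.
\<close>

lemma chebyshev_dist_le_iff: "chebyshev_dist r s \<le> c \<longleftrightarrow> (\<forall>i. \<bar>r $ i - s $ i\<bar> \<le> c)"
  unfolding chebyshev_dist_def by simp

lemma weighted_max_dist_le_iff:
  assumes "m \<ge> 1"
  shows "weighted_max_dist m r w x \<le> L \<longleftrightarrow>
    (\<forall>i. (MAX j\<in>{1..m}. r j $ i + w j) - L \<le> x $ i \<and> x $ i \<le> (MIN j\<in>{1..m}. r j $ i - w j) + L)"
proof -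
  have "weighted_max_dist m r w x \<le> L \<longleftrightarrow> (\<forall>j\<in>{1..m}. chebyshev_dist (r j) x \<le> L - w j)"
    using assms unfolding weighted_max_dist_def by (simp add: le_diff_eq)
  \<comment> \<open>Exchanging the quantifiers over \<open>j\<close> and \<open>i\<close> separates
    the coordinates.\<close>
  also have "\<dots> \<longleftrightarrow> (\<forall>i. (\<forall>j\<in>{1..m}. r j $ i + w j \<le> x $ i + L) \<and> (\<forall>j\<in>{1..m}. x $ i - L \<le> r j $ i - w j))"
    unfolding chebyshev_dist_le_iff abs_le_iff by (auto simp: algebra_simps)
  \<comment> \<open>Collecting the bounds into \<open>MAX\<close> and \<open>MIN\<close> relies on
    \<open>{1..m}\<close> being nonempty, hence on \<open>m \<ge> 1\<close>.\<close>
  also have "\<dots> \<longleftrightarrow> (\<forall>i. (MAX j\<in>{1..m}. r j $ i + w j) \<le> x $ i + L \<and> x $ i - L \<le> (MIN j\<in>{1..m}. r j $ i - w j))"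
    using assms by simp
  finally show ?thesis
    by (simp add: algebra_simps)
qed

theorem corollary3:
  fixes m :: nat
    and r :: "nat \<Rightarrow> real ^ 'n"
    and w :: "nat \<Rightarrow> real"
    and p q :: "real ^ 'n"
    and lam :: real
  assumes "m \<ge> 2"
    and "\<And>i. p $ i = (MAX j\<in>{1..m}. r j $ i + w j)"
    and "\<And>i. q $ i = (MIN j\<in>{1..m}. r j $ i - w j)"
    and "lam = (MAX i\<in>UNIV. p $ i - q $ i) / 2"
  shows "(\<exists>x. weighted_max_dist m r w x = lam)
    \<and> (\<forall>x. lam \<le> weighted_max_dist m r w x)
    \<and> (\<forall>\<alpha>. 0 \<le> \<alpha> \<and> \<alpha> \<le> 1 \<longrightarrow>
          weighted_max_dist m r w
            (\<alpha> *\<^sub>R (\<chi> i. p $ i - lam) + (1 - \<alpha>) *\<^sub>R (\<chi> i. q $ i + lam)) = lam)"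
proof -
  have le_iff: "weighted_max_dist m r w x \<le> L \<longleftrightarrow> (\<forall>i. p $ i - L \<le> x $ i \<and> x $ i \<le> q $ i + L)" for x L
    using weighted_max_dist_le_iff[of m r w x L] assms(1-3) by simp
  have lam_le_iff: "lam \<le> L \<longleftrightarrow> (\<forall>i. p $ i - L \<le> q $ i + L)" for L
  proof -
    have "lam \<le> L \<longleftrightarrow> (MAX i\<in>UNIV. p $ i - q $ i) \<le> L * 2"
      unfolding assms(4) by (rule divide_le_eq_numeral1(1))
    then show ?thesis
      by (simp add: algebra_simps)
  qed
  \<comment> \<open>Each \<open>x\<close> lies in the box at the height of its own objective value,
    so that box is nonempty.\<close>
  have lower: "lam \<le> weighted_max_dist m r w x" for x
    using le_iff[of x "weighted_max_dist m r w x"] order_trans unfolding lam_le_iff by blast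
  have attained: "weighted_max_dist m r w
      (\<alpha> *\<^sub>R (\<chi> i. p $ i - lam) + (1 - \<alpha>) *\<^sub>R (\<chi> i. q $ i + lam)) = lam"
    if "0 \<le> \<alpha>" "\<alpha> \<le> 1" for \<alpha>
  proof (rule antisym[OF _ lower], unfold le_iff, intro allI)
    fix i
    \<comment> \<open>This is \<open>lam_le_iff\<close> at \<open>L = lam\<close>, where the left
      side is reflexivity.\<close>
    have "p $ i - lam \<le> q $ i + lam"
      using lam_le_iff by blast
    \<comment> \<open>A convex combination of the two endpoints stays in the interval.\<close>
    then have "\<alpha> * (p $ i - lam) + (1 - \<alpha>) * (q $ i + lam) \<in> {p $ i - lam..q $ i + lam}"
      using that convexD[OF convex_real_interval(5), of "p $ i - lam" "p $ i - lam" "q $ i + lam" "q $ i + lam" \<alpha> "1 - \<alpha>"]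
      by simp
    then show "p $ i - lam \<le> (\<alpha> *\<^sub>R (\<chi> i. p $ i - lam) + (1 - \<alpha>) *\<^sub>R (\<chi> i. q $ i + lam)) $ i \<and>
        (\<alpha> *\<^sub>R (\<chi> i. p $ i - lam) + (1 - \<alpha>) *\<^sub>R (\<chi> i. q $ i + lam)) $ i \<le> q $ i + lam"
      by simp
  qed
  show ?thesis
    \<comment> \<open>\<open>\<alpha> = 0\<close> supplies the minimizer, the upper corner of the
      box.\<close>
    using lower attained attained[of 0] by auto
qed

end
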